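(* Let $n,p$ be positive integers such that $n$ and $n+p$ are relatively prime. For all polynomials $P\in\Pi_{2n,2p}^2$ the quadrature formula $$\frac{1}{\pi^2}\int_{-1}^1\int_{-1}^1 P(x,y)\,\frac{1}{\sqrt{1-x^2}}\,\frac{1}{\sqrt{1-y^2}}\,dx\,dy = \sum_{\mathcal{A}\in\mathrm{LD}_{n,p}} w_{\mathcal{A}}\,P(\mathcal{A})$$ is exact.
   Context: $\gamma_{n,p}(t) = (\cos(nt),\cos((n+p)t))$, $t_k := \frac{\pi k}{n(n+p)}$, and $\mathrm{LD}_{n,p} := \{\gamma_{n,p}(t_k): k=0,\ldots,n(n+p)\}\subset[-1,1]^2$ (a finite set; coinciding points are counted once). Quadrature weights for $\mathcal{A}\in\mathrm{LD}_{n,p}$: $w_{\mathcal{A}} = \frac{1}{2n(n+p)}$ if $\mathcal{A}\in\{\gamma_{n,p}(0),\gamma_{n,p}(\pi)\}$ (vertex points); $w_{\mathcal{A}}=\frac{1}{n(n+p)}$ if $\mathcal{A}$ is any other point of $\mathrm{LD}_{n,p}$ on the boundary of $[-1,1]^2$ (edge points); $w_{\mathcal{A}}=\frac{2}{n(n+p)}$ if $\mathcal{A}$ lies in the interior of $[-1,1]^2$. For positive integers $N,q$, $\Pi_{N,q}^2 := \mathrm{span}\{T_i(x)T_j(y): (i,j)\in\mathbb{N}_0^2,\ \frac{i}{N+q}+\frac{j}{N}<1\}$, where $T_i(x)=\cos(i\arccos x)$ are the Chebyshev polynomials of the first kind. In particular $\Pi_{2n,2p}^2$ is spanned by the $T_i(x)T_j(y)$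 with $\frac{i}{2n+2p}+\frac{j}{2n}<1$. *)

theory Defs
  imports
    "HOL-Analysis.Analysis"
    "HOL-Computational_Algebra.Polynomial"
    "HOL-Library.Function_Algebras"
begin

definition cheb_T :: "nat \<Rightarrow> real poly" where
  "cheb_T i = (THE q. \<forall>x\<in>{-1..1}. poly q x = cos (real i * arccos x))"

lemma cheb_T_exists: "\<exists>q. \<forall>x\<in>{-1..1}. poly q x = cos (real i * arccos x)"
proof (induction i rule: less_induct)
  case (less i)
  consider "i = 0" | "i = 1" | k where "i = Suc (Suc k)"
    by (metis One_nat_def not0_implies_Suc)
  then show ?case
  proof cases
    case 1
    then show ?thesis by (intro exI[of _ 1]) simp
  next
    case 2
    then show ?thesis by (intro exI[of _ "[:0, 1:]"]) simp
  next
    case (3 k)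
    obtain q r where q: "\<And>x. x \<in> {-1..1} \<Longrightarrow> poly q x = cos (real (Suc k) * arccos x)"
      and r: "\<And>x. x \<in> {-1..1} \<Longrightarrow> poly r x = cos (real k * arccos x)"
      using less[of "Suc k"] less[of k] 3 by (metis lessI less_SucI)
    have "poly ([:0, 2:] * q - r) x = cos (real i * arccos x)" if x: "x \<in> {-1..1}" for x
    proof -
      define t where "t = arccos x"
      have ct: "cos t = x" using x by (simp add: t_def)
      have a: "cos (real i * t) = cos (real (Suc k) * t + t)"
        by (simp add: 3 algebra_simps)
      have b: "cos (real k * t) = cos (real (Suc k) * t - t)"
        by (simp add: algebra_simps)
      have "cos (real i * t) + cos (real k * t) = 2 * x * cos (real (Suc k) * t)"
        unfolding a b cos_add cos_diff ct by simp
      then show ?thesis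
        using q[OF x] r[OF x] by (simp add: t_def algebra_simps)
    qed
    then show ?thesis by blast
  qed
qed

lemma poly_eq_on_Icc:
  fixes q r :: "real poly"
  assumes "\<forall>x\<in>{-1..1}. poly q x = poly r x"
  shows "q = r"
proof (rule ccontr)
  assume "q \<noteq> r"
  then have "finite {x. poly (q - r) x = 0}"
    by (intro poly_roots_finite) simp
  moreover have "{-1..1} \<subseteq> {x. poly (q - r) x = 0}"
    using assms by auto
  ultimately have "finite {-1..1::real}"
    by (rule rev_finite_subset)
  then show False
    using infinite_Icc[of "-1::real" 1] by simp
qed

lemma poly_cheb_T:
  assumes "x \<in> {-1..1}"
  shows "poly (cheb_T i) x = cos (real i * arccos x)"
proof -
  have "\<exists>!q. \<forall>x\<in>{-1..1}. poly q x = cos (real i * arccos x)"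
    using cheb_T_exists[of i] by (auto intro!: poly_eq_on_Icc)
  from theI'[OF this] assms show ?thesis
    by (simp add: cheb_T_def)
qed

text \<open>Bivariate real polynomials are represented by the functions on the plane they induce;
  the scalar multiplication for the span is pointwise.\<close>

definition cheb_space :: "nat \<Rightarrow> nat \<Rightarrow> (real \<times> real \<Rightarrow> real) set" where
  "cheb_space N q = module.span (\<lambda>c f z. c * f z)
     {\<lambda>(x, y). poly (cheb_T i) x * poly (cheb_T j) y | i j.
        real i / real (N + q) + real j / real N < 1}"

lemma vector_space_fun: "vector_space (\<lambda>(c::real) (f :: real \<times> real \<Rightarrow> real) z. c * f z)"
  by unfold_locales (auto simp: fun_eq_iff algebra_simps)

definition lissajous :: "nat \<Rightarrow> nat \<Rightarrow> real \<Rightarrow> real \<times> real" where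
  "lissajous n p t = (cos (real n * t), cos (real (n + p) * t))"

definition LD_time :: "nat \<Rightarrow> nat \<Rightarrow> nat \<Rightarrow> real" where
  "LD_time n p k = pi * real k / real (n * (n + p))"

definition LD :: "nat \<Rightarrow> nat \<Rightarrow> (real \<times> real) set" where
  "LD n p = (\<lambda>k. lissajous n p (LD_time n p k)) ` {0..n * (n + p)}"

text \<open>The final default value 0 is irrelevant: all points of \<^term>\<open>LD n p\<close> lie in the closed square.\<close>

definition LD_weight :: "nat \<Rightarrow> nat \<Rightarrow> real \<times> real \<Rightarrow> real" where
  "LD_weight n p A =
    (if A \<in> {lissajous n p 0, lissajous n p pi} then 1 / (2 * real (n * (n + p)))
     else if A \<in> frontier ({-1..1} \<times> {-1..1}) then 1 / real (n * (n + p))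
     else if A \<in> interior ({-1..1} \<times> {-1..1}) then 2 / real (n * (n + p))
     else 0)"

end

theory Submission
  imports Defs "HOL-Number_Theory.Cong"
begin

text \<open>By linearity it suffices to treat products of Chebyshev polynomials. With m = n + p, the
  parameter k of the curve may run over a full period of 2mn integers. The node of k determines k
  modulo 2m and modulo 2n only up to sign, so by the Chinese remainder theorem a node is hit
  1, 2 or 4 times when it is a vertex, an edge point or an interior point: exactly the ratio of the
  weights. Hence the quadrature sum is the mean over a full period. At a product of Chebyshev
  polynomials of degrees i and j this mean is half the sum of the means of
  cos(\<pi>(in - jm)k/mn) and cos(\<pi>(in + jm)k/mn). Sums over roots of unity make both vanish unless
  2mn divides the frequency, which in the given degree range forces i = j = 0.\<close>

section \<open>Cosines at rational multiples of pi as statements about congruence and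
  divisibility\<close>

lemma cos_pi_quotient_eq_iff:
  fixes a b L :: int
  assumes "L > 0"
  shows "cos (pi * a / L) = cos (pi * b / L) \<longleftrightarrow> [a = b] (mod 2 * L) \<or> [a = - b] (mod 2 * L)"
proof -
  have *: "pi * a / L = pi * c / L + 2 * of_int k * pi \<longleftrightarrow> a = c + 2 * L * k" for c k :: int
  proof -
    have "pi * a / L = pi * c / L + 2 * of_int k * pi \<longleftrightarrow> pi * real_of_int a = pi * real_of_int (c + 2 * L * k)"
      using assms by (simp add: field_simps)
    also have "\<dots> \<longleftrightarrow> a = c + 2 * L * k" by (metis mult_cancel_left of_int_eq_iff pi_neq_zero)
    finally show ?thesis .
  qed
  have "cos (pi * a / L) = cos (pi * b / L) \<longleftrightarrow>
      (\<exists>k::int. pi * a / L = pi * b / L + 2 * of_int k * pi \<or> pi * a / L = - (pi * b / L) + 2 * of_int k * pi)"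
    unfolding cos_eq by (auto simp: Ints_def)
  also have "\<dots> \<longleftrightarrow> (\<exists>k::int. a = b + 2 * L * k) \<or> (\<exists>k. a = - b + 2 * L * k)"
    using *[of b] *[of "- b"] by auto
  also have "\<dots> \<longleftrightarrow> [a = b] (mod 2 * L) \<or> [a = - b] (mod 2 * L)"
    by (metis cong_iff_lin cong_sym_eq)
  finally show ?thesis .
qed

text \<open>A coordinate of absolute value 1 is what puts a point of the square on its boundary, so
  this turns the vertex, edge and interior cases into divisibility conditions on the
  parameter.\<close>

lemma abs_cos_pi_quotient_eq_1_iff:
  fixes b L :: int
  assumes "L > 0"
  shows "\<bar>cos (pi * b / L)\<bar> = 1 \<longleftrightarrow> L dvd b"
proof -
  have "\<bar>cos (pi * b / L)\<bar> = 1 \<longleftrightarrow> sin (pi * b / L) = 0"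
    using sin_cos_squared_add[of "pi * b / L"]
    by (smt (verit) power2_eq_1_iff power2_abs zero_eq_power2)
  also have "\<dots> \<longleftrightarrow> (\<exists>k::int. pi * b / L = of_int k * pi)"
    by (rule sin_zero_iff_int2)
  also have "\<dots> \<longleftrightarrow> (\<exists>k::int. b = L * k)"
  proof -
    have "pi * b / L = of_int k * pi \<longleftrightarrow> b = L * k" for k :: int
    proof -
      have "pi * b / L = of_int k * pi \<longleftrightarrow> pi * real_of_int b = pi * real_of_int (L * k)"
        using assms by (simp add: field_simps)
      also have "\<dots> \<longleftrightarrow> b = L * k" by (metis mult_cancel_left of_int_eq_iff pi_neq_zero)
      finally show ?thesis .
    qed
    then show ?thesis by simp
  qed
  finally show ?thesis by (simp add: dvd_def)
qed

section \<open>Fibres of the cosine and of the parametrisation of the nodes\<close>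

definition cos_fibre :: "int \<Rightarrow> int \<Rightarrow> int set" where
  "cos_fibre L b = {a \<in> {0..<2 * L}. cos (pi * a / L) = cos (pi * b / L)}"

text \<open>The fibre consists of the residues of \<open>b\<close> and \<open>- b\<close> modulo
  \<open>2 * L\<close>, and these coincide exactly when \<open>2 * L\<close> divides
  \<open>2 * b\<close>.\<close>

lemma card_cos_fibre:
  fixes b L :: int
  assumes "L > 0"
  shows "card (cos_fibre L b) = (if L dvd b then 1 else 2)"
proof -
  have "cos_fibre L b = {b mod (2 * L), (- b) mod (2 * L)}"
    using assms unfolding cos_fibre_def cos_pi_quotient_eq_iff[OF assms]
    by (auto simp: cong_def)
  moreover have "b mod (2 * L) = (- b) mod (2 * L) \<longleftrightarrow> L dvd b"
  proof -
    have "b mod (2 * L) = (- b) mod (2 * L) \<longleftrightarrow> 2 * L dvd 2 * b"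
      by (simp add: mod_eq_dvd_iff)
    then show ?thesis by simp
  qed
  ultimately show ?thesis by auto
qed

text \<open>For \<open>m = n + p\<close> this is the curve at time pi k / (m n): each frequency
  cancels against one factor of the denominator, which leaves \<open>m\<close> in the first
  coordinate and \<open>n\<close> in the second. Integer parameters make signs and congruences
  available.\<close>

definition node :: "int \<Rightarrow> int \<Rightarrow> int \<Rightarrow> real \<times> real" where
  "node m n k = (cos (pi * k / m), cos (pi * k / n))"

text \<open>Reduction modulo \<open>2 * m\<close> and \<open>2 * n\<close> maps the fibre of the
  node bijectively onto the product of the two cosine fibres. It is injective on one period because
  the least common multiple of the two moduli is \<open>2 * (m * n)\<close>.\<close>

lemma card_node_fibre:
  fixes m n l :: int
  assumes "m > 0" "n > 0" "coprime m n"
  shows "card {k \<in> {0..<2 * (m * n)}. node m n k = node m n l} =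
    card (cos_fibre m l) * card (cos_fibre n l)"
proof -
  let ?f = "\<lambda>k::int. (k mod (2 * m), k mod (2 * n))"
  let ?K = "{k \<in> {0..<2 * (m * n)}. node m n k = node m n l}"
  have cong: "[k mod (2 * m) = k] (mod 2 * m)" "[k mod (2 * n) = k] (mod 2 * n)" for k
    by (simp_all add: cong_def)
  have "bij_betw ?f ?K (cos_fibre m l \<times> cos_fibre n l)"
    unfolding bij_betw_def
  proof
    show "inj_on ?f ?K"
    proof (rule inj_onI)
      fix j k assume jk: "j \<in> ?K" "k \<in> ?K" "?f j = ?f k"
      then have "2 * m dvd j - k" and "2 * n dvd j - k"
        by (auto simp: mod_eq_dvd_iff)
      \<comment> \<open>Only after the common factor 2 is cancelled are the divisors
        coprime.\<close>
      moreover then obtain d where d: "j - k = 2 * d"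
        by (metis dvd_def mult.assoc)
      ultimately have "m * n dvd d"
        using assms by (auto intro: divides_mult)
      then have "2 * (m * n) dvd j - k" using d by simp
      then have "j mod (2 * (m * n)) = k mod (2 * (m * n))"
        by (simp add: mod_eq_dvd_iff)
      then show "j = k" using jk by simp
    qed
    show "?f ` ?K = cos_fibre m l \<times> cos_fibre n l"
    proof (intro equalityI subsetI)
      fix z assume "z \<in> ?f ` ?K"
      then obtain k where k: "k \<in> ?K" "z = ?f k" by blast
      have "cos (pi * of_int (k mod (2 * m)) / m) = cos (pi * k / m)"
        "cos (pi * of_int (k mod (2 * n)) / n) = cos (pi * k / n)"
        using cong assms by (simp_all only: cos_pi_quotient_eq_iff simp_thms)
      then show "z \<in> cos_fibre m l \<times> cos_fibre n l"
        using k assms by (auto simp: cos_fibre_def node_def)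
    next
      fix z assume z: "z \<in> cos_fibre m l \<times> cos_fibre n l"
      obtain a b where ab: "z = (a, b)" by fastforce
      have a: "a \<in> {0..<2 * m}" "cos (pi * a / m) = cos (pi * l / m)"
        and b: "b \<in> {0..<2 * n}" "cos (pi * b / n) = cos (pi * l / n)"
        using z ab by (auto simp: cos_fibre_def)
      \<comment> \<open>The moduli 2m and 2n are not coprime; equal parity of the residues makes them compatible.\<close>
      have "even (a - l)" "even (b - l)"
        using a(2) b(2) assms
        by (auto simp: cos_pi_quotient_eq_iff cong_iff_dvd_diff dest!: dvd_mult_left)
      then have "even (b - a)" by presburger
      then obtain d where d: "b - a = 2 * d" by blast
      obtain u v where uv: "u * m + v * n = 1"
        using assms(3) by (metis bezout_int coprime_iff_gcd_eq_1)
      \<comment> \<open>The added term is invisible modulo \<open>2 * m\<close>. Since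
        \<open>u * m\<close> is 1 modulo \<open>n\<close>, it amounts to
        \<open>2 * d = b - a\<close> modulo \<open>2 * n\<close> and so moves \<open>a\<close> to
        \<open>b\<close>.\<close>
      define k where "k = (a + 2 * m * (u * d)) mod (2 * (m * n))"
      have "k mod (2 * m) = (a + 2 * m * (u * d)) mod (2 * m)"
        unfolding k_def by (rule mod_mod_cancel) auto
      then have km: "k mod (2 * m) = a" using a(1) by simp
      have "k mod (2 * n) = (a + 2 * m * (u * d)) mod (2 * n)"
        unfolding k_def by (rule mod_mod_cancel) auto
      also have "a + 2 * m * (u * d) = b + 2 * n * (- v * d)"
        using uv d by algebra
      finally have "k mod (2 * n) = b mod (2 * n)" by (simp only: mod_mult_self2)
      then have kn: "k mod (2 * n) = b" using b(1) by simp
      have "cos (pi * k / m) = cos (pi * a / m)" "cos (pi * k / n) = cos (pi * b / n)"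
        using cong[of k] assms by (simp_all only: cos_pi_quotient_eq_iff km kn cong_sym_eq simp_thms)
      moreover have "k \<in> {0..<2 * (m * n)}" unfolding k_def using assms by simp
      ultimately have "k \<in> ?K" using a b by (simp add: node_def)
      then show "z \<in> ?f ` ?K" using km kn ab by (intro image_eqI[of _ _ k]) auto
    qed
  qed
  from bij_betw_same_card[OF this] show ?thesis by (simp add: card_cartesian_product)
qed

section \<open>The quadrature sum as a mean over a full period\<close>

lemma LD_eq_node_image:
  assumes "n > 0"
  shows "LD n p = node (int (n + p)) (int n) ` {0..<2 * (int (n + p) * int n)}"
proof -
  let ?m = "int (n + p)" and ?n = "int n"
  let ?M = "?m * ?n"
  have pos: "?m > 0" "?n > 0" using assms by auto
  have lis: "lissajous n p (LD_time n p k) = node ?m ?n (int k)" for k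
    using assms by (simp add: lissajous_def LD_time_def node_def del: of_nat_add)
  have "LD n p = node ?m ?n ` int ` {0..n * (n + p)}"
    unfolding LD_def image_image lis ..
  also have "int ` {0..n * (n + p)} = {0..?M}"
    by (simp add: image_int_atLeastAtMost mult.commute)
  \<comment> \<open>The second half of the period retraces the first: by evenness and periodicity of
    the cosine, \<open>2 * ?M - k\<close> gives the same node as \<open>k\<close>.\<close>
  also have "node ?m ?n ` {0..?M} = node ?m ?n ` {0..<2 * ?M}"
  proof (intro equalityI subsetI)
    fix z assume "z \<in> node ?m ?n ` {0..?M}"
    moreover have "?M > 0" using pos by simp
    ultimately show "z \<in> node ?m ?n ` {0..<2 * ?M}" by auto
  next
    fix z assume "z \<in> node ?m ?n ` {0..<2 * ?M}"
    then obtain k where k: "k \<in> {0..<2 * ?M}" "z = node ?m ?n k" by blast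
    have "[2 * (a * b) - k = - k] (mod 2 * a)" "[2 * (a * b) - k = - k] (mod 2 * b)" for a b :: int
      by (simp_all add: cong_iff_dvd_diff)
    then have "[2 * ?M - k = - k] (mod 2 * ?m)" "[2 * ?M - k = - k] (mod 2 * ?n)"
      by this+
    then have "node ?m ?n (2 * ?M - k) = node ?m ?n k"
      using pos by (simp only: node_def cos_pi_quotient_eq_iff prod.inject simp_thms)
    then show "z \<in> node ?m ?n ` {0..?M}"
      using k by (cases "k \<le> ?M") (auto simp: mult.commute intro!: image_eqI[of _ _ "2 * ?M - k"])
  qed
  finally show ?thesis .
qed

text \<open>Both sides depend only on which of \<open>n + p\<close> and \<open>n\<close> divide a
  parameter \<open>l\<close> of \<open>A\<close>: both at a vertex, exactly one at an edge point,
  neither in the interior.\<close>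

lemma LD_weight_eq_card_fibre:
  assumes "n > 0" "coprime n (n + p)" "A \<in> LD n p"
  shows "LD_weight n p A =
    card {k \<in> {0..<2 * (int (n + p) * int n)}. node (int (n + p)) (int n) k = A}
      / (2 * real (n * (n + p)))"
proof -
  let ?m = "int (n + p)" and ?n = "int n"
  have pos: "?m > 0" "?n > 0" using assms by auto
  have cop: "coprime ?m ?n" using assms(2) by (simp add: coprime_commute del: of_nat_add)
  obtain l where l: "l \<in> {0..<2 * (?m * ?n)}" "A = node ?m ?n l"
    using assms LD_eq_node_image by blast
  have sq: "A \<in> {-1..1} \<times> {-1..1}" by (simp add: l node_def)
  have vertex: "A \<in> {lissajous n p 0, lissajous n p pi} \<longleftrightarrow> ?m dvd l \<and> ?n dvd l"
  proof -
    \<comment> \<open>The end time pi of the curve belongs to the parameter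
      \<open>?m * ?n\<close>.\<close>
    have *: "lissajous n p 0 = node ?m ?n 0" "lissajous n p pi = node ?m ?n (?m * ?n)"
      using assms by (simp_all add: lissajous_def node_def mult.commute)
    show ?thesis
    proof
      assume "A \<in> {lissajous n p 0, lissajous n p pi}"
      then have "\<bar>fst A\<bar> = 1 \<and> \<bar>snd A\<bar> = 1"
        unfolding * node_def by (auto simp del: of_nat_add of_int_of_nat_eq
            simp: abs_cos_pi_quotient_eq_1_iff pos)
      then show "?m dvd l \<and> ?n dvd l"
        unfolding l node_def fst_conv snd_conv abs_cos_pi_quotient_eq_1_iff[OF pos(1)]
          abs_cos_pi_quotient_eq_1_iff[OF pos(2)] .
    next
      assume "?m dvd l \<and> ?n dvd l"
      \<comment> \<open>Within one period the only multiples of \<open>?m * ?n\<close> are 0 and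
        \<open>?m * ?n\<close> itself. Hence a node in a corner of the square is one of the two
        vertex points.\<close>
      then have "?m * ?n dvd l" using cop by (intro divides_mult) auto
      then obtain c where c: "l = ?m * ?n * c" by blast
      have M: "?m * ?n > 0" using pos by simp
      have "0 \<le> ?m * ?n * c" "?m * ?n * c < ?m * ?n * 2" using l c by auto
      then have "0 \<le> c" "c < 2"
        using M by (auto simp only: zero_le_mult_iff mult_less_cancel_left_pos)
      then have "c = 0 \<or> c = 1" by auto
      then show "A \<in> {lissajous n p 0, lissajous n p pi}"
        unfolding * using l c by auto
    qed
  qed
  have "A \<in> interior ({-1..1} \<times> {-1..1}) \<longleftrightarrow> \<bar>fst A\<bar> \<noteq> 1 \<and> \<bar>snd A\<bar> \<noteq> 1"
    using sq by (cases A) (auto simp: interior_Times)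
  also have "\<dots> \<longleftrightarrow> \<not> ?m dvd l \<and> \<not> ?n dvd l"
    unfolding l node_def fst_conv snd_conv abs_cos_pi_quotient_eq_1_iff[OF pos(1)]
          abs_cos_pi_quotient_eq_1_iff[OF pos(2)] ..
  finally have interior: "A \<in> interior ({-1..1} \<times> {-1..1}) \<longleftrightarrow> \<not> ?m dvd l \<and> \<not> ?n dvd l" .
  have frontier: "A \<in> frontier ({-1..1} \<times> {-1..1}) \<longleftrightarrow> A \<notin> interior ({-1..1} \<times> {-1..1})"
    using sq by (simp add: frontier_def closure_Times)
  show ?thesis
    unfolding LD_weight_def vertex frontier interior
    unfolding l(2) card_node_fibre[OF pos cop] card_cos_fibre[OF pos(1)] card_cos_fibre[OF pos(2)]
    by auto
qed

text \<open>Grouping the full-period sum by nodes repeats each value as often as its fibre has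
  elements, which is the weight times the period length.\<close>

lemma LD_quadrature_eq_node_mean:
  assumes "n > 0" "coprime n (n + p)"
  shows "(\<Sum>A\<in>LD n p. LD_weight n p A * P A) =
    (\<Sum>k\<in>{0..<2 * (int (n + p) * int n)}. P (node (int (n + p)) (int n) k)) / (2 * real (n * (n + p)))"
proof -
  let ?N = "node (int (n + p)) (int n)" and ?K = "{0..<2 * (int (n + p) * int n)}"
  have "(\<Sum>k\<in>?K. P (?N k)) = (\<Sum>A\<in>?N ` ?K. \<Sum>k\<in>{k \<in> ?K. ?N k = A}. P (?N k))"
    by (rule sum.image_gen) simp
  also have "\<dots> = (\<Sum>A\<in>LD n p. real (card {k \<in> ?K. ?N k = A}) * P A)"
    unfolding LD_eq_node_image[OF assms(1)] by (intro sum.cong) auto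
  also have "\<dots> = (\<Sum>A\<in>LD n p. 2 * real (n * (n + p)) * (LD_weight n p A * P A))"
    using assms by (intro sum.cong) (auto simp: LD_weight_eq_card_fibre simp del: of_nat_add)
  also have "\<dots> = 2 * real (n * (n + p)) * (\<Sum>A\<in>LD n p. LD_weight n p A * P A)"
    by (rule sum_distrib_left[symmetric])
  finally show ?thesis
    using assms by simp
qed

section \<open>Evaluation of the quadrature sum at products of Chebyshev polynomials\<close>

lemma sum_cos_root_of_unity:
  fixes s M :: int
  assumes "M > 0"
  shows "(\<Sum>k\<in>{0..<2 * M}. cos (pi * (s * k) / M)) = (if 2 * M dvd s then 2 * M else 0)"
proof -
  define \<theta> where "\<theta> = pi * s / M"
  define N where "N = nat (2 * M)"
  have N: "real N = 2 * M" "{0..<2 * M} = int ` {..<N}"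
    using assms by (auto simp: N_def image_int_atLeastLessThan lessThan_atLeast0)
  have "(\<Sum>k\<in>{0..<2 * M}. cos (pi * (s * k) / M)) = (\<Sum>k<N. cos (real k * \<theta>))"
    unfolding N(2) by (subst sum.reindex) (auto simp: \<theta>_def field_simps)
  \<comment> \<open>A geometric sum over a root of unity of order dividing \<open>N\<close>, which
    vanishes unless the root is 1.\<close>
  also have "\<dots> = Re (\<Sum>k<N. cis \<theta> ^ k)"
    by (simp only: Complex.DeMoivre Re_sum cis.sel)
  finally have eq: "(\<Sum>k\<in>{0..<2 * M}. cos (pi * (s * k) / M)) = Re (\<Sum>k<N. cis \<theta> ^ k)" .
  \<comment> \<open>Writing 1 as the cosine of the angle with numerator 0 lets the congruence
    criterion decide when the root is trivial.\<close>
  have "cis \<theta> = 1 \<longleftrightarrow> cos \<theta> = cos (pi * (0::int) / M)"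
    by (auto simp: complex_eq_iff cos_one_sin_zero)
  also have "\<dots> \<longleftrightarrow> 2 * M dvd s"
    unfolding \<theta>_def cos_pi_quotient_eq_iff[OF assms] by (simp add: cong_iff_dvd_diff)
  finally have one: "cis \<theta> = 1 \<longleftrightarrow> 2 * M dvd s" .
  have "real N * \<theta> = 2 * pi * s" using assms by (simp add: N \<theta>_def)
  then have "cis \<theta> ^ N = 1"
    by (simp only: Complex.DeMoivre) (simp add: cis_multiple_2pi)
  then have "(\<Sum>k<N. cis \<theta> ^ k) = (if 2 * M dvd s then of_nat N else 0)"
    using one geometric_sum[of "cis \<theta>" N] by auto
  then show ?thesis unfolding eq by (simp add: N)
qed

text \<open>The angles at the nodes leave the range of \<open>arccos\<close>. There
  \<open>arccos (cos x)\<close> differs from \<open>x\<close> only by a sign and a multiple of 2 pi,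
  and neither changes the cosine of an integer multiple.\<close>

lemma poly_cheb_T_cos: "poly (cheb_T i) (cos x) = cos (real i * x)"
proof -
  obtain k :: int where k: "arccos (cos x) = \<bar>x - of_int k * (2 * pi)\<bar>"
    by (rule arccos_cos_eq_abs_2pi)
  have "cos (real i * \<bar>y\<bar>) = cos (real i * y)" for y :: real
    by (cases "y \<ge> 0") auto
  then have "poly (cheb_T i) (cos x) = cos (real i * (x - of_int k * (2 * pi)))"
    using k by (simp add: poly_cheb_T)
  also have "\<dots> = cos (real i * x - 2 * pi * of_int (int i * k))"
    by (simp add: algebra_simps)
  also have "\<dots> = cos (real i * x)"
    unfolding cos_diff by (simp only: cos_int_2pin sin_int_2pin)
  finally show ?thesis .
qed

text \<open>The discrete counterpart of \<open>cheb_integral_cheb_T\<close>, after division by pi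
  squared.\<close>

lemma LD_quadrature_cheb_T:
  assumes "n > 0" "coprime n (n + p)"
    and ij: "real i / real (2 * n + 2 * p) + real j / real (2 * n) < 1"
  shows "(\<Sum>A\<in>LD n p. LD_weight n p A * (poly (cheb_T i) (fst A) * poly (cheb_T j) (snd A))) =
    (if i = 0 \<and> j = 0 then 1 else 0)"
proof -
  define m where "m = int (n + p)"
  define n' where "n' = int n"
  \<comment> \<open>Over the common denominator \<open>m * n'\<close>, the two factors oscillate
    with frequencies \<open>s\<close> and \<open>t\<close>, and the degree bound becomes
    \<open>s + t < 2 * (m * n')\<close>.\<close>
  define s where "s = int i * n'"
  define t where "t = int j * m"
  have pos: "m > 0" "n' > 0" "m * n' > 0" using assms by (auto simp: m_def n'_def)
  have cop: "coprime m n'" using assms(2) by (simp add: m_def n'_def coprime_commute del: of_nat_add)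
  have prod: "poly (cheb_T i) (fst (node m n' k)) * poly (cheb_T j) (snd (node m n' k)) =
      (cos (pi * ((s - t) * k) / (m * n')) + cos (pi * ((s + t) * k) / (m * n'))) / 2" for k
  proof -
    have "real i * (pi * k / m) = pi * (s * k) / (m * n')"
      "real j * (pi * k / n') = pi * (t * k) / (m * n')"
      using pos by (auto simp: s_def t_def field_simps)
    then show ?thesis
      unfolding node_def fst_conv snd_conv poly_cheb_T_cos
      by (simp only: cos_times_cos) (simp add: algebra_simps diff_divide_distrib add_divide_distrib)
  qed
  have "real i / real (2 * n + 2 * p) + real j / real (2 * n) = (s + t) / (2 * (m * n'))"
    using pos by (simp add: s_def t_def m_def n'_def divide_simps) (simp add: algebra_simps)
  then have "real_of_int (s + t) < real_of_int (2 * (m * n'))"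
    using ij pos by (simp add: divide_less_eq)
  then have lt: "s + t < 2 * (m * n')" by (simp only: of_int_less_iff)
  have nonneg: "s \<ge> 0" "t \<ge> 0" using pos by (simp_all add: s_def t_def)
  have zero: "s = 0 \<longleftrightarrow> i = 0" "t = 0 \<longleftrightarrow> j = 0" using pos by (auto simp: s_def t_def)
  have small: "2 * (m * n') dvd r \<longleftrightarrow> r = 0" if "\<bar>r\<bar> < 2 * (m * n')" for r
    using that zdvd_not_zless[of "\<bar>r\<bar>" "2 * (m * n')"] by auto
  have plus: "2 * (m * n') dvd s + t \<longleftrightarrow> i = 0 \<and> j = 0"
    using small[of "s + t"] lt nonneg zero by auto
  have minus: "2 * (m * n') dvd s - t \<longleftrightarrow> i = 0 \<and> j = 0"
  proof -
    \<comment> \<open>Equal frequencies cancel whatever their size, so the degree bound alone does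
      not suffice. Coprimality makes \<open>s\<close> a multiple of \<open>m * n'\<close>, while
      \<open>2 * s = s + t\<close> stays below \<open>2 * (m * n')\<close>; thus \<open>s\<close> is
      0.\<close>
    have "i = 0" if "s = t"
    proof -
      have "m dvd int i * n'" using that by (simp add: s_def t_def)
      then have "m dvd int i" using cop by (simp add: coprime_dvd_mult_left_iff)
      then obtain c where "int i = m * c" by blast
      then have c: "s = m * n' * c" by (simp add: s_def)
      then have "m * n' * c < m * n' * 1" "0 \<le> m * n' * c" using lt that nonneg by linarith+
      then have "c < 1" "0 \<le> c" using pos(3) by (simp_all only: zero_le_mult_iff mult_less_cancel_left_pos) auto
      then have "c = 0" by simp
      then show ?thesis using c zero by simp
    qed
    then show ?thesis using small[of "s - t"] lt nonneg zero by auto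
  qed
  have real_M: "2 * real (n * (n + p)) = 2 * of_int (m * n')" by (simp add: m_def n'_def)
  have "(\<Sum>A\<in>LD n p. LD_weight n p A * (poly (cheb_T i) (fst A) * poly (cheb_T j) (snd A))) =
    (\<Sum>k\<in>{0..<2 * (m * n')}. poly (cheb_T i) (fst (node m n' k)) * poly (cheb_T j) (snd (node m n' k)))
      / (2 * (m * n'))"
    using LD_quadrature_eq_node_mean[OF assms(1,2)] unfolding m_def[symmetric] n'_def[symmetric] real_M by simp
  also have "\<dots> = ((if 2 * (m * n') dvd s - t then 2 * (m * n') else 0) +
      (if 2 * (m * n') dvd s + t then 2 * (m * n') else 0)) / 2 / (2 * (m * n'))"
    unfolding prod by (simp only: sum_divide_distrib[symmetric] sum.distrib
        sum_cos_root_of_unity[OF pos(3)] of_int_add)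
  also have "\<dots> = (if i = 0 \<and> j = 0 then 1 else 0)"
    using pos unfolding plus minus by simp
  finally show ?thesis .
qed

section \<open>One-dimensional integrals against the Chebyshev weight\<close>

lemma set_integrable_greaterThanLessThan_iff_Icc:
  fixes f :: "real \<Rightarrow> real"
  shows "set_integrable lborel {a<..<b} f \<longleftrightarrow> set_integrable lborel {a..b} f"
  by (rule set_integrable_discrete_difference[where X = "{a, b}"]) auto

text \<open>The weight is unbounded near both endpoints, so integrability does not follow from
  continuity. It comes from the fundamental theorem for nonnegative integrands: the antiderivative
  \<open>- arccos x\<close> is differentiable only inside the interval but has limits at its
  ends.\<close>

lemma inverse_sqrt_integral:
  shows "set_integrable lborel {-1..1} (\<lambda>x. 1 / sqrt (1 - x\<^sup>2))" (is ?A)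
    and "(LBINT x:{-1..1}. 1 / sqrt (1 - x\<^sup>2)) = pi" (is ?B)
proof -
  let ?F = "\<lambda>x. - arccos x"
  have cont: "continuous_on {-1..1} ?F" by (intro continuous_intros) auto
  have deriv: "(?F has_real_derivative 1 / sqrt (1 - x\<^sup>2)) (at x)" if "-1 < x" "x < 1" for x
    using that by (auto intro!: derivative_eq_intros simp: field_simps)
  have lim: "((?F \<circ> real_of_ereal) \<longlongrightarrow> ?F (-1)) (at_right (ereal (-1)))"
    "((?F \<circ> real_of_ereal) \<longlongrightarrow> ?F 1) (at_left (ereal 1))"
    unfolding ereal_tendsto_simps
    using continuous_on_Icc_at_rightD[OF cont] continuous_on_Icc_at_leftD[OF cont] by auto
  have "1 - x\<^sup>2 > 0" if "-1 < x" "x < 1" for x :: real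
    using that by (simp add: abs_square_less_1)
  then have c: "isCont (\<lambda>x. 1 / sqrt (1 - x\<^sup>2)) x" if "-1 < x" "x < 1" for x :: real
    using that by (intro continuous_intros) fastforce+
  have nn: "0 \<le> 1 / sqrt (1 - x\<^sup>2)" if "-1 < x" "x < 1" for x :: real
    using that by (simp add: abs_square_le_1)
  note FTC = interval_integral_FTC_nonneg[where a = "ereal (-1)" and b = "ereal 1", OF _ _ _ _ lim]
  show ?A unfolding set_integrable_greaterThanLessThan_iff_Icc[symmetric] einterval_eq_Icc[symmetric]
    by (rule FTC) (use deriv c nn in auto)
  have "(LBINT x=ereal (-1)..ereal 1. 1 / sqrt (1 - x\<^sup>2)) = ?F 1 - ?F (-1)"
    by (rule FTC) (use deriv c nn in auto)
  then show ?B by (simp add: interval_integral_Icc)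
qed


lemma cheb_T_integral:
  shows "set_integrable lborel {-1..1} (\<lambda>x. poly (cheb_T i) x * (1 / sqrt (1 - x\<^sup>2)))" (is ?A)
    and "(LBINT x:{-1..1}. poly (cheb_T i) x * (1 / sqrt (1 - x\<^sup>2))) = (if i = 0 then pi else 0)" (is ?B)
proof -
  let ?f = "\<lambda>x. poly (cheb_T i) x * (1 / sqrt (1 - x\<^sup>2))"
  show A: ?A
  proof (rule set_integrable_bound[OF inverse_sqrt_integral(1)])
    show "set_borel_measurable lborel {-1..1} ?f"
      unfolding set_borel_measurable_def
      using borel_measurable_continuous_onI[OF continuous_on_poly[OF continuous_on_id], of "cheb_T i"]
      by measurable
    \<comment> \<open>The bound by 1 makes the weight itself an integrable majorant.\<close>
    have "\<bar>poly (cheb_T i) x\<bar> \<le> 1" if "x \<in> {-1..1}" for x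
      using that by (simp add: poly_cheb_T)
    then show "AE x in lborel. x \<in> {-1..1} \<longrightarrow> norm (?f x) \<le> norm (1 / sqrt (1 - x\<^sup>2))"
      by (auto simp: divide_right_mono intro!: AE_I2)
  qed
  show ?B
  proof (cases "i = 0")
    case True
    have "(LBINT x:{-1..1}. ?f x) = (LBINT x:{-1..1}. 1 / sqrt (1 - x\<^sup>2))"
      using True by (intro set_lebesgue_integral_cong) (auto simp: poly_cheb_T)
    then show ?thesis using inverse_sqrt_integral(2) True by simp
  next
    case False
    \<comment> \<open>The substitution x = cos t turns the integrand into a cosine of frequency
      \<open>i\<close>, whence this antiderivative for nonzero \<open>i\<close>. It vanishes at both
      endpoints.\<close>
    let ?F = "\<lambda>x. - sin (real i * arccos x) / real i"
    have cont: "continuous_on {-1..1} ?F" using False by (intro continuous_intros) auto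
    have deriv: "(?F has_real_derivative ?f x) (at x)" if "-1 < x" "x < 1" for x
      using that False by (auto intro!: derivative_eq_intros simp: poly_cheb_T field_simps)
    have lim: "((?F \<circ> real_of_ereal) \<longlongrightarrow> ?F (-1)) (at_right (ereal (-1)))"
      "((?F \<circ> real_of_ereal) \<longlongrightarrow> ?F 1) (at_left (ereal 1))"
      unfolding ereal_tendsto_simps
      using continuous_on_Icc_at_rightD[OF cont] continuous_on_Icc_at_leftD[OF cont] by auto
    have "1 - x\<^sup>2 > 0" if "-1 < x" "x < 1" for x :: real
      using that by (simp add: abs_square_less_1)
    then have c: "isCont ?f x" if "-1 < x" "x < 1" for x :: real
      using that by (intro continuous_intros) fastforce+
    have "(LBINT x=ereal (-1)..ereal 1. ?f x) = ?F 1 - ?F (-1)"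
      using lim by (intro interval_integral_FTC_integrable)
        (use deriv c A in \<open>auto simp: has_real_derivative_iff_has_vector_derivative
          set_integrable_greaterThanLessThan_iff_Icc\<close>)
    moreover have "sin (real i * pi) = 0" by simp
    ultimately show ?thesis using False by (simp add: interval_integral_Icc)
  qed
qed

section \<open>Linearity of the weighted double integral and exactness on the span\<close>

definition cheb_integral :: "(real \<times> real \<Rightarrow> real) \<Rightarrow> real" where
  "cheb_integral P = (LBINT y:{-1..1}. LBINT x:{-1..1}.
     P (x, y) * (1 / sqrt (1 - x\<^sup>2)) * (1 / sqrt (1 - y\<^sup>2)))"

text \<open>Additivity of an iterated integral needs integrability at both levels. The inner
  condition can be asked for every real \<open>y\<close>, since for a product of Chebyshev
  polynomials everything depending on \<open>y\<close> is a constant factor there.\<close>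

definition cheb_integrable :: "(real \<times> real \<Rightarrow> real) \<Rightarrow> bool" where
  "cheb_integrable P \<longleftrightarrow>
     (\<forall>y. set_integrable lborel {-1..1} (\<lambda>x. P (x, y) * (1 / sqrt (1 - x\<^sup>2)) * (1 / sqrt (1 - y\<^sup>2)))) \<and>
     set_integrable lborel {-1..1}
       (\<lambda>y. LBINT x:{-1..1}. P (x, y) * (1 / sqrt (1 - x\<^sup>2)) * (1 / sqrt (1 - y\<^sup>2)))"

lemma cheb_integral_add:
  assumes "cheb_integrable P" "cheb_integrable Q"
  shows "cheb_integrable (P + Q)" "cheb_integral (P + Q) = cheb_integral P + cheb_integral Q"
  using assms unfolding cheb_integrable_def cheb_integral_def plus_fun_def distrib_right
  by (simp_all add: set_integral_add)

lemma cheb_integral_scale: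
  assumes "cheb_integrable P"
  shows "cheb_integrable (\<lambda>z. c * P z)" "cheb_integral (\<lambda>z. c * P z) = c * cheb_integral P"
  using assms
  unfolding cheb_integrable_def cheb_integral_def mult.assoc set_integral_mult_right
  by (auto simp only: intro!: set_integrable_mult_right)

text \<open>The integrand separates into a factor in x and a factor in y, so the double integral is
  a product of two one-dimensional ones.\<close>

lemma cheb_integral_cheb_T:
  shows "cheb_integrable (\<lambda>(x, y). poly (cheb_T i) x * poly (cheb_T j) y)"
    and "cheb_integral (\<lambda>(x, y). poly (cheb_T i) x * poly (cheb_T j) y) =
      (if i = 0 \<and> j = 0 then pi\<^sup>2 else 0)"
proof -
  have *: "(case (x, y) of (x, y) \<Rightarrow> poly (cheb_T i) x * poly (cheb_T j) y) *
      (1 / sqrt (1 - x\<^sup>2)) * (1 / sqrt (1 - y\<^sup>2)) =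
      (poly (cheb_T i) x * (1 / sqrt (1 - x\<^sup>2))) * (poly (cheb_T j) y * (1 / sqrt (1 - y\<^sup>2)))" for x y
    by simp
  show "cheb_integrable (\<lambda>(x, y). poly (cheb_T i) x * poly (cheb_T j) y)"
    unfolding cheb_integrable_def * set_integral_mult_left
    by (intro conjI allI set_integrable_mult_left set_integrable_mult_right cheb_T_integral(1))
  show "cheb_integral (\<lambda>(x, y). poly (cheb_T i) x * poly (cheb_T j) y) =
      (if i = 0 \<and> j = 0 then pi\<^sup>2 else 0)"
    unfolding cheb_integral_def * set_integral_mult_left set_integral_mult_right cheb_T_integral(2)
    by (simp add: power2_eq_square)
qed

theorem theorem5:
  fixes n p :: nat and P :: "real \<times> real \<Rightarrow> real"
  assumes "n > 0" and "p > 0" and "coprime n (n + p)"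
    and "P \<in> cheb_space (2 * n) (2 * p)"
  shows "1 / pi\<^sup>2 *
      (LBINT y:{-1..1}. LBINT x:{-1..1}. P (x, y) * (1 / sqrt (1 - x\<^sup>2)) * (1 / sqrt (1 - y\<^sup>2)))
    = (\<Sum>A\<in>LD n p. LD_weight n p A * P A)"
proof -
  interpret vector_space "\<lambda>(c::real) (f :: real \<times> real \<Rightarrow> real) z. c * f z"
    by (rule vector_space_fun)
  \<comment> \<open>Exactness alone is not visibly closed under addition; carrying integrability
    along makes the set a subspace, so that the generators suffice.\<close>
  define exact where "exact P \<longleftrightarrow> cheb_integrable P \<and>
    1 / pi\<^sup>2 * cheb_integral P = (\<Sum>A\<in>LD n p. LD_weight n p A * P A)" for P
  have "exact P"
    using assms(4) unfolding cheb_space_def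
  proof (induction rule: span_induct)
    case base
    show ?case
    proof (rule subspaceI; unfold mem_Collect_eq)
      show "exact 0"
        by (simp add: exact_def cheb_integrable_def cheb_integral_def set_integrable_def set_lebesgue_integral_def)
    next
      fix P Q assume "exact P" "exact Q"
      then show "exact (P + Q)"
        by (simp add: exact_def cheb_integral_add distrib_left sum.distrib)
    next
      fix c P assume "exact P"
      then have P: "cheb_integrable P"
        "1 / pi\<^sup>2 * cheb_integral P = (\<Sum>A\<in>LD n p. LD_weight n p A * P A)"
        by (auto simp: exact_def)
      have "1 / pi\<^sup>2 * cheb_integral (\<lambda>z. c * P z) = c * (1 / pi\<^sup>2 * cheb_integral P)"
        by (simp add: cheb_integral_scale(2)[OF P(1)])
      then show "exact (\<lambda>z. c * P z)"
        unfolding exact_def P(2)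
        by (simp add: cheb_integral_scale(1)[OF P(1)] sum_distrib_left mult.left_commute)
    qed
  next
    case (step f)
    then obtain i j where f: "f = (\<lambda>(x, y). poly (cheb_T i) x * poly (cheb_T j) y)"
      and ij: "real i / real (2 * n + 2 * p) + real j / real (2 * n) < 1"
      by blast
    show ?case
      using LD_quadrature_cheb_T[OF assms(1,3) ij] cheb_integral_cheb_T[of i j]
      unfolding exact_def f by (simp add: split_beta)
  qed
  then show ?thesis by (simp add: exact_def cheb_integral_def)
qed

end
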